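(* Let $T\in\mathcal T$ have parameters $\alpha,\gamma,\mathbf D,C_0,C_1$. For $\varepsilon>0$ let $T_\varepsilon\in\mathcal T$ be the map with the same angle $\alpha$ and the same centers $C_0,C_1$ but with discontinuity line $\mathbf D_\varepsilon=e^{i\varepsilon}\mathbf D$ (and half-planes $e^{i\varepsilon}\mathbf P_0$, $e^{i\varepsilon}\mathbf P_1$). Let $z_u$ be a periodic point of $T$ of weight $w$ associated to a word $u\in\{0,1\}^n$ of length $n$ (with $e^{in\alpha}\ne 1$). Then for every $\varepsilon>0$ such that $$w_\varepsilon:=w-2\big(|z_u|+n\,N(T)\big)\,|\sin(\varepsilon/2)|>0,$$ the point $z_u$ is a periodic point of $T_\varepsilon$ (associated to the word $u$) with weight greater than or equal to $w_\varepsilon$.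
   Context: Identify $\mathbb R^2$ with $\mathbb C$. Class $\mathcal T$: fix $\alpha\in\mathbb R$ with $e^{i\alpha}\ne1$, $\gamma\in\mathbb R$, and distinct $C_0,C_1\in\mathbb C$. Let $\mathbf D=e^{i\gamma}\mathbb R$ (a line through $0$), let $\mathbf P_0=\{z:\operatorname{Im}(e^{-i\gamma}z)>0\}$ and $\mathbf P_1=\mathbb C\setminus\mathbf P_0$. The associated map $T:\mathbb C\to\mathbb C$ is $T(z)=e^{i\alpha}(z-C_j)+C_j$ if $z\in\mathbf P_j$, $j\in\{0,1\}$; $\mathcal T$ is the set of all such maps. $N(T)=\sup\{\,\big||T(z)|-|z|\big| : z\in\mathbb C\}$ (written with triple bars around $T$ in the source). For a word $u=u_0\dots u_{n-1}\in\{0,1\}^n$ with $n\ge1$ and $e^{in\alpha}\neq1$, let $z_u=\frac{1-e^{i\alpha}}{1-e^{in\alpha}}\sum_{k=0}^{n-1}e^{i(n-k-1)\alpha}C_{u_k}$, the unique fixed point of $r_{u_{n-1}}\circ\cdots\circ r_{u_0}$, where $r_j(z)=e^{i\alpha}(z-C_j)+C_j$. It is a periodic point of $T$ associated to $u$ when $T^k(z_u)\in\mathbf P_{u_k}$ for all $0\le k\le n-1$; its weight (for $T$) is $\min\{d(T^k(z_u),\mathbf D):0\le k\le n-1\}$, with $d$ the Euclidean distance. For $T_\varepsilon$ the same definitions are used with $T_\varepsilon$, $e^{i\varepsilon}\mathbf P_j$ and $e^{i\varepsilon}\mathbf D$. *)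

theory Defs
  imports "HOL-Analysis.Analysis"
begin

definition rot :: "real \<Rightarrow> complex \<Rightarrow> complex \<Rightarrow> complex" where
  "rot \<alpha> c z = cis \<alpha> * (z - c) + c"

definition disc_line :: "real \<Rightarrow> complex set" where
  "disc_line \<gamma> = range (\<lambda>t::real. cis \<gamma> * of_real t)"

text \<open>Indices \<open>j\<close> range over \<open>{0, 1}\<close>; values at other indices are never used.\<close>

definition half_plane :: "real \<Rightarrow> nat \<Rightarrow> complex set" where
  "half_plane \<gamma> j =
    (if j = 0 then {z. Im (cis (- \<gamma>) * z) > 0} else - {z. Im (cis (- \<gamma>) * z) > 0})"

text \<open>The map is parametrised by the pair of half-planes \<open>P 0\<close>, \<open>P 1\<close>, which are always
  complementary, so the \<open>else\<close> branch is the case \<open>z \<in> P 1\<close>.\<close>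

definition pw_rot :: "real \<Rightarrow> (nat \<Rightarrow> complex) \<Rightarrow> (nat \<Rightarrow> complex set) \<Rightarrow> complex \<Rightarrow> complex" where
  "pw_rot \<alpha> C P z = (if z \<in> P 0 then rot \<alpha> (C 0) z else rot \<alpha> (C 1) z)"

definition class_T :: "(complex \<Rightarrow> complex) set" where
  "class_T = {pw_rot \<alpha> C (half_plane \<gamma>) | \<alpha> C \<gamma>. cis \<alpha> \<noteq> 1 \<and> C 0 \<noteq> C 1}"

definition rotated :: "real \<Rightarrow> complex set \<Rightarrow> complex set" where
  "rotated \<epsilon> S = (\<lambda>z. cis \<epsilon> * z) ` S"

definition displacement :: "(complex \<Rightarrow> complex) \<Rightarrow> real" where
  "displacement T = (SUP z. \<bar>cmod (T z) - cmod z\<bar>)"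

definition word_point :: "real \<Rightarrow> (nat \<Rightarrow> complex) \<Rightarrow> nat list \<Rightarrow> complex" where
  "word_point \<alpha> C u = (let n = length u in
     (1 - cis \<alpha>) / (1 - cis (real n * \<alpha>)) * (\<Sum>k<n. cis (real (n - k - 1) * \<alpha>) * C (u ! k)))"

definition follows_word ::
    "(complex \<Rightarrow> complex) \<Rightarrow> (nat \<Rightarrow> complex set) \<Rightarrow> nat list \<Rightarrow> complex \<Rightarrow> bool" where
  "follows_word T P u z \<longleftrightarrow> (\<forall>k<length u. (T ^^ k) z \<in> P (u ! k))"

definition periodic_point_of ::
    "real \<Rightarrow> (nat \<Rightarrow> complex) \<Rightarrow> (complex \<Rightarrow> complex) \<Rightarrow> (nat \<Rightarrow> complex set) \<Rightarrow> nat list \<Rightarrow> complex \<Rightarrow> bool"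
  where
  "periodic_point_of \<alpha> C T P u z \<longleftrightarrow>
     u \<noteq> [] \<and> set u \<subseteq> {0, 1} \<and> cis (real (length u) * \<alpha>) \<noteq> 1 \<and>
     z = word_point \<alpha> C u \<and> follows_word T P u z"

definition weight :: "(complex \<Rightarrow> complex) \<Rightarrow> complex set \<Rightarrow> nat \<Rightarrow> complex \<Rightarrow> real" where
  "weight T D n z = Min ((\<lambda>k. infdist ((T ^^ k) z) D) ` {..<n})"

text \<open>Rotating the line and the half-planes by \<open>\<epsilon>\<close> amounts to replacing \<open>\<gamma>\<close> by \<open>\<gamma> + \<epsilon>\<close>; hence
  the rotated map stays in the class.\<close>

lemma rotated_disc_line: "rotated \<epsilon> (disc_line \<gamma>) = disc_line (\<gamma> + \<epsilon>)"
  unfolding rotated_def disc_line_def image_image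
  by (simp add: cis_mult mult.assoc[symmetric] add.commute)

lemma rotated_iff: "z \<in> rotated \<epsilon> S \<longleftrightarrow> cis (- \<epsilon>) * z \<in> S"
proof
  assume "cis (- \<epsilon>) * z \<in> S"
  moreover have "z = cis \<epsilon> * (cis (- \<epsilon>) * z)"
    by (simp add: cis_mult mult.assoc[symmetric])
  ultimately show "z \<in> rotated \<epsilon> S" unfolding rotated_def by blast
qed (auto simp: rotated_def cis_mult mult.assoc[symmetric])

lemma rotated_half_plane: "rotated \<epsilon> (half_plane \<gamma> j) = half_plane (\<gamma> + \<epsilon>) j"
proof -
  have "cis (- \<gamma>) * (cis (- \<epsilon>) * z) = cis (- (\<gamma> + \<epsilon>)) * z" for z
    by (simp add: cis_mult mult.assoc[symmetric])
  then have "Im (cis (- \<gamma>) * (cis (- \<epsilon>) * z)) = Im (cis (- (\<gamma> + \<epsilon>)) * z)" for z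
    by (simp only:)
  then show ?thesis
    by (cases "j = 0")
      (simp_all only: set_eq_iff rotated_iff half_plane_def if_True if_False mem_Collect_eq
        Compl_iff simp_thms)
qed

lemma pw_rot_rotated_in_class_T:
  assumes "cis \<alpha> \<noteq> 1" "C 0 \<noteq> C 1"
  shows "pw_rot \<alpha> C (\<lambda>j. rotated \<epsilon> (half_plane \<gamma> j)) \<in> class_T"
  unfolding rotated_half_plane class_T_def using assms by blast

text \<open>The supremum of real numbers in \<open>displacement\<close> is over a bounded set.\<close>

lemma bdd_above_displacement:
  "bdd_above (range (\<lambda>z. \<bar>cmod (pw_rot \<alpha> C P z) - cmod z\<bar>))"
proof -
  have *: "\<bar>cmod (rot \<alpha> c z) - cmod z\<bar> \<le> cmod ((1 - cis \<alpha>) * c)" for c z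
  proof -
    have "rot \<alpha> c z = cis \<alpha> * z + (1 - cis \<alpha>) * c"
      by (simp add: rot_def algebra_simps)
    moreover have "cmod (cis \<alpha> * z) = cmod z"
      by (simp add: norm_mult)
    ultimately show ?thesis
      using norm_triangle_ineq3[of "rot \<alpha> c z" "cis \<alpha> * z"] by simp
  qed
  have "\<bar>cmod (pw_rot \<alpha> C P z) - cmod z\<bar>
      \<le> max (cmod ((1 - cis \<alpha>) * C 0)) (cmod ((1 - cis \<alpha>) * C 1))" for z
    using *[of "C 0" z] *[of "C 1" z] by (simp add: pw_rot_def le_max_iff_disj)
  then show ?thesis by (intro bdd_aboveI2)
qed

text \<open>\<open>word_point \<alpha> C u\<close> is the unique fixed point of the composition of the rotations
  along \<open>u\<close>.\<close>

lemma fold_rot: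
  "fold (\<lambda>j. rot \<alpha> (C j)) u z = cis (real (length u) * \<alpha>) * z +
     (1 - cis \<alpha>) * (\<Sum>k<length u. cis (real (length u - k - 1) * \<alpha>) * C (u ! k))"
proof (induction u rule: rev_induct)
  case (snoc x xs)
  let ?n = "length xs"
  have "(\<Sum>k<?n. cis (real (?n - k) * \<alpha>) * C ((xs @ [x]) ! k)) =
        (\<Sum>k<?n. cis \<alpha> * (cis (real (?n - k - 1) * \<alpha>) * C (xs ! k)))"
  proof (rule sum.cong)
    fix k assume "k \<in> {..<?n}"
    then have k: "k < ?n" by simp
    then have "real (?n - k) * \<alpha> = \<alpha> + real (?n - k - 1) * \<alpha>"
      by (simp add: of_nat_diff algebra_simps)
    then have "cis (real (?n - k) * \<alpha>) = cis \<alpha> * cis (real (?n - k - 1) * \<alpha>)"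
      by (simp only: cis_mult)
    with k show "cis (real (?n - k) * \<alpha>) * C ((xs @ [x]) ! k) =
        cis \<alpha> * (cis (real (?n - k - 1) * \<alpha>) * C (xs ! k))"
      by (simp add: nth_append)
  qed simp
  moreover have "cis (real (length (xs @ [x])) * \<alpha>) = cis \<alpha> * cis (real ?n * \<alpha>)"
    by (simp add: cis_mult algebra_simps)
  ultimately show ?case
    unfolding fold_append by (simp add: snoc.IH rot_def sum_distrib_left[symmetric])
      (simp only: ring_distribs mult.assoc, simp add: mult_ac)
qed simp

lemma fixed_point_iff_word_point:
  assumes "cis (real (length u) * \<alpha>) \<noteq> 1"
  shows "fold (\<lambda>j. rot \<alpha> (C j)) u z = z \<longleftrightarrow> z = word_point \<alpha> C u"
proof -
  have "1 - cis (real (length u) * \<alpha>) \<noteq> 0" using assms by simp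
  then show ?thesis
    by (auto simp: fold_rot word_point_def Let_def field_simps)
qed

end

theory Submission
  imports Defs
begin

text \<open>The \<open>k\<close>-th orbit point has modulus at most \<open>|z| + k N(T)\<close>, and rotating the line by
  \<open>\<epsilon>\<close> changes the signed distance of a point \<open>x\<close> to it by at most
  \<open>|x| |exp(i\<epsilon>) - 1| = 2 |x| |sin(\<epsilon>/2)|\<close>. As long as this stays below the weight, no orbit
  point changes sides, so both maps have the same orbit up to time \<open>n\<close>.\<close>

text \<open>Multiplication by \<open>cis (- \<gamma>)\<close> is an isometry taking the line to the
  real axis. There the nearest point to y is \<open>Re y\<close>, and every real point is at
  distance at least \<open>\<bar>Im y\<bar>\<close>.\<close>

lemma infdist_disc_line: "infdist z (disc_line \<gamma>) = \<bar>Im (cis (- \<gamma>) * z)\<bar>"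
proof (rule antisym)
  have dist_eq: "dist z (cis \<gamma> * of_real t) = cmod (cis (- \<gamma>) * z - of_real t)" for t
  proof -
    have "cmod (cis (- \<gamma>) * (z - cis \<gamma> * of_real t)) = dist z (cis \<gamma> * of_real t)"
      by (simp add: norm_mult dist_norm)
    moreover have "cis (- \<gamma>) * (z - cis \<gamma> * of_real t) = cis (- \<gamma>) * z - of_real t"
      by (simp add: right_diff_distrib mult.assoc[symmetric] cis_mult)
    ultimately show ?thesis by simp
  qed
  let ?y = "cis (- \<gamma>) * z"
  have "infdist z (disc_line \<gamma>) \<le> dist z (cis \<gamma> * of_real (Re ?y))"
    by (intro infdist_le) (unfold disc_line_def, rule rangeI)
  also have "\<dots> = cmod (Complex 0 (Im ?y))"
    unfolding dist_eq by (rule arg_cong[where f = cmod]) (simp only: complex_eq_iff; simp)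
  finally show "infdist z (disc_line \<gamma>) \<le> \<bar>Im ?y\<bar>"
    by (simp add: cmod_def)
  have "\<bar>Im ?y\<bar> \<le> dist z x" if "x \<in> disc_line \<gamma>" for x
  proof -
    from that obtain t where "x = cis \<gamma> * of_real t"
      by (auto simp: disc_line_def)
    then show ?thesis
      using abs_Im_le_cmod[of "?y - of_real t"] by (simp add: dist_eq)
  qed
  moreover have "disc_line \<gamma> \<noteq> {}"
    by (simp add: disc_line_def)
  ultimately show "\<bar>Im ?y\<bar> \<le> infdist z (disc_line \<gamma>)"
    unfolding infdist_def by (auto intro: cINF_greatest)
qed

text \<open>Pulling out the half angle leaves a purely imaginary factor: exp(it) - 1 = exp(it/2) *
  2i sin(t/2).\<close>

lemma cmod_cis_minus_one: "cmod (cis t - 1) = 2 * \<bar>sin (t / 2)\<bar>"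
proof -
  have "cis t - 1 = cis (t / 2) * (2 * \<i> * of_real (sin (t / 2)))"
    using cos_double_sin[of "t / 2"] sin_double[of "t / 2"]
    by (simp add: complex_eq_iff power2_eq_square)
  then show ?thesis
    by (simp add: norm_mult)
qed

lemma abs_Im_cis_diff_le:
  "\<bar>Im (cis (- (\<gamma> + \<epsilon>)) * z) - Im (cis (- \<gamma>) * z)\<bar> \<le> 2 * cmod z * \<bar>sin (\<epsilon> / 2)\<bar>"
proof -
  \<comment> \<open>The common factor has modulus 1, so only \<open>cis (- \<epsilon>) - 1\<close>
    counts; the sign of \<epsilon> disappears in the absolute value of the sine.\<close>
  have "cis (- (\<gamma> + \<epsilon>)) * z - cis (- \<gamma>) * z = cis (- \<gamma>) * ((cis (- \<epsilon>) - 1) * z)"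
    by (simp add: ring_distribs mult.assoc[symmetric] cis_mult)
  then have "cmod (cis (- (\<gamma> + \<epsilon>)) * z - cis (- \<gamma>) * z) = 2 * cmod z * \<bar>sin (\<epsilon> / 2)\<bar>"
    by (simp add: norm_mult cmod_cis_minus_one)
  then show ?thesis
    by (metis abs_Im_le_cmod minus_complex.simps(2))
qed

lemma abs_cmod_diff_le_displacement:
  "\<bar>cmod (pw_rot \<alpha> C P z) - cmod z\<bar> \<le> displacement (pw_rot \<alpha> C P)"
  unfolding displacement_def by (rule cSUP_upper[OF UNIV_I bdd_above_displacement])

lemma cmod_funpow_pw_rot_le:
  "cmod ((pw_rot \<alpha> C P ^^ k) z) \<le> cmod z + real k * displacement (pw_rot \<alpha> C P)"
proof (induction k)
  case (Suc k)
  then show ?case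
    using abs_cmod_diff_le_displacement[of \<alpha> C P "(pw_rot \<alpha> C P ^^ k) z"]
    by (simp add: algebra_simps)
qed simp

text \<open>\<open>pw_rot\<close> consults its half-planes only through membership in the one of
  index 0. Agreement is assumed along the orbit for \<open>P\<close> alone; the induction carries it
  over to the orbit for \<open>Q\<close>, up to and including time \<open>n\<close>.\<close>

lemma funpow_pw_rot_cong:
  assumes "\<And>k. k < n \<Longrightarrow> (pw_rot \<alpha> C P ^^ k) z \<in> P 0 \<longleftrightarrow> (pw_rot \<alpha> C P ^^ k) z \<in> Q 0"
    and "k \<le> n"
  shows "(pw_rot \<alpha> C Q ^^ k) z = (pw_rot \<alpha> C P ^^ k) z"
  using assms(2)
proof (induction k)
  case (Suc k)
  then have "(pw_rot \<alpha> C Q ^^ k) z = (pw_rot \<alpha> C P ^^ k) z" by simp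
  then show ?case
    using assms(1)[of k] Suc.prems by (simp add: pw_rot_def[of _ _ _ "(_ ^^ _) _"])
qed simp

theorem proposition20:
  fixes \<alpha> \<gamma> \<epsilon> w w\<epsilon> :: real and C :: "nat \<Rightarrow> complex"
    and P P\<epsilon> :: "nat \<Rightarrow> complex set" and D D\<epsilon> :: "complex set"
    and T T\<epsilon> :: "complex \<Rightarrow> complex" and u :: "nat list" and n :: nat and z\<^sub>u :: complex
  assumes "cis \<alpha> \<noteq> 1" and "C 0 \<noteq> C 1"
    and "D = disc_line \<gamma>" and "P = half_plane \<gamma>" and "T = pw_rot \<alpha> C P"
    and "n = length u" and "periodic_point_of \<alpha> C T P u z\<^sub>u" and "w = weight T D n z\<^sub>u"
    and "\<epsilon> > 0"
    and "D\<epsilon> = rotated \<epsilon> D" and "P\<epsilon> = (\<lambda>j. rotated \<epsilon> (P j))" and "T\<epsilon> = pw_rot \<alpha> C P\<epsilon>"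
    and "w\<epsilon> = w - 2 * (cmod z\<^sub>u + real n * displacement T) * \<bar>sin (\<epsilon> / 2)\<bar>"
    and "w\<epsilon> > 0"
  shows "periodic_point_of \<alpha> C T\<epsilon> P\<epsilon> u z\<^sub>u \<and> weight T\<epsilon> D\<epsilon> n z\<^sub>u \<ge> w\<epsilon>"
proof -
  define x where "x k = (T ^^ k) z\<^sub>u" for k
  \<comment> \<open>The signed distance to the line of angle t, positive exactly on the half-plane
    of index 0.\<close>
  define f where "f t z = Im (cis (- t) * z)" for t z
  have P\<epsilon>: "P\<epsilon> = half_plane (\<gamma> + \<epsilon>)"
    using assms by (simp add: rotated_half_plane)
  have D\<epsilon>: "D\<epsilon> = disc_line (\<gamma> + \<epsilon>)"
    using assms by (simp add: rotated_disc_line)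
  have n: "n > 0"
    using assms by (simp add: periodic_point_of_def)
  have close: "\<bar>f (\<gamma> + \<epsilon>) (x k) - f \<gamma> (x k)\<bar> \<le> w - w\<epsilon>" if "k < n" for k
  proof -
    \<comment> \<open>Nonnegativity, read off at the single point 0, lets the bound at time
      \<open>k\<close> be weakened to the uniform one at \<open>n\<close>.\<close>
    have "0 \<le> displacement T"
      using abs_cmod_diff_le_displacement[of \<alpha> C P 0] assms(5) by (simp add: order_trans[OF norm_ge_zero])
    then have "real k * displacement T \<le> real n * displacement T"
      using that by (intro mult_right_mono) auto
    then have "cmod (x k) \<le> cmod z\<^sub>u + real n * displacement T"
      using cmod_funpow_pw_rot_le[where k = k and z = z\<^sub>u and \<alpha> = \<alpha> and C = C and P = P] assms(5)
      by (simp add: x_def)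
    then have "2 * cmod (x k) * \<bar>sin (\<epsilon> / 2)\<bar> \<le> w - w\<epsilon>"
      using assms(13) by (simp add: mult_right_mono)
    then show ?thesis
      using abs_Im_cis_diff_le[of \<gamma> \<epsilon> "x k"] by (simp only: f_def)
  qed
  have far: "w \<le> \<bar>f \<gamma> (x k)\<bar>" if "k < n" for k
  proof -
    have "w \<le> infdist (x k) D"
      unfolding assms(8) weight_def x_def using that by (intro Min_le) auto
    then show ?thesis by (simp only: assms(3) infdist_disc_line f_def)
  qed
  \<comment> \<open>The signed distance has size at least \<open>w\<close> and moves by at most
    \<open>w - w\<epsilon>\<close>, so it keeps its sign and a size of at least
    \<open>w\<epsilon> > 0\<close>.\<close>
  have same_side: "f (\<gamma> + \<epsilon>) (x k) > 0 \<longleftrightarrow> f \<gamma> (x k) > 0"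
    and far\<epsilon>: "w\<epsilon> \<le> \<bar>f (\<gamma> + \<epsilon>) (x k)\<bar>" if "k < n" for k
    using close[OF that] far[OF that] assms(14) by linarith+
  \<comment> \<open>One sign decides every index, since the other half-plane is the
    complement.\<close>
  have same_plane: "x k \<in> P\<epsilon> j \<longleftrightarrow> x k \<in> P j" if "k < n" for k j
    using same_side[OF that] unfolding P\<epsilon> assms(4) half_plane_def f_def by simp
  have orbit: "(T\<epsilon> ^^ k) z\<^sub>u = x k" if "k < n" for k
    unfolding x_def assms(5) assms(12)
    by (rule funpow_pw_rot_cong[of n])
      (use that same_plane[of _ 0] in \<open>simp_all add: x_def assms(5)\<close>)
  have "follows_word T P u z\<^sub>u"
    using assms(7) unfolding periodic_point_of_def by blast
  then have "follows_word T\<epsilon> P\<epsilon> u z\<^sub>u"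
    unfolding follows_word_def assms(6)[symmetric]
    by (simp add: orbit same_plane flip: x_def)
  then have "periodic_point_of \<alpha> C T\<epsilon> P\<epsilon> u z\<^sub>u"
    using assms(7) unfolding periodic_point_of_def by blast
  moreover have "w\<epsilon> \<le> infdist ((T\<epsilon> ^^ k) z\<^sub>u) D\<epsilon>" if "k < n" for k
    using far\<epsilon>[OF that] by (simp only: orbit[OF that] D\<epsilon> infdist_disc_line f_def)
  then have "w\<epsilon> \<le> weight T\<epsilon> D\<epsilon> n z\<^sub>u"
    unfolding weight_def using n by (subst Min_ge_iff) auto
  ultimately show ?thesis ..
qed

end
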